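(* Let $k\geq 2$ be an integer and let $G$ be a (not necessarily finite) nilpotent group of nilpotency class $k$. Then the group $\mathrm{P}(G)$, i.e. the subgroup of the automorphism group of $G$ generated by all polynomial automorphisms of $G$, is nilpotent of class $k-1$.
   Context: For a group $G$, $\mathrm{A}(G)$ denotes its automorphism group. An automorphism $f\in \mathrm{A}(G)$ is called a polynomial automorphism of $G$ if there exist integers $\epsilon_1,\ldots,\epsilon_m\in\mathbb{Z}$ and elements $u_0,\ldots,u_m\in G$ such that $f(x)=u_0x^{\epsilon_1}u_1\cdots u_{m-1}x^{\epsilon_m}u_m$ for all $x\in G$ (equivalently, since $f(1)=1$, there exist integers $\epsilon_1,\ldots,\epsilon_m$ and elements $v_1,\ldots,v_m\in G$ with $f(x)=(v_1^{-1}x^{\epsilon_1}v_1)\cdots(v_m^{-1}x^{\epsilon_m}v_m)$ for all $x\in G$). $\mathrm{P}(G)$ denotes the subgroup of $\mathrm{A}(G)$ generated by the set of all polynomial automorphisms of $G$. "Nilpotent of class $c$" means of nilpotency class exactly $c$. *)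

theory Defs
  imports "HOL-Algebra.Algebra"
begin

text \<open>Indexed from 0: \<open>lower_central G n\<close> is the term usually written \<open>\<gamma>\<close> with index \<open>n + 1\<close>.\<close>

primrec lower_central :: "('a, 'b) monoid_scheme \<Rightarrow> nat \<Rightarrow> 'a set" where
  "lower_central G 0 = carrier G"
| "lower_central G (Suc n) = generate G
     (\<Union>x \<in> lower_central G n. \<Union>y \<in> carrier G. {x \<otimes>\<^bsub>G\<^esub> y \<otimes>\<^bsub>G\<^esub> inv\<^bsub>G\<^esub> x \<otimes>\<^bsub>G\<^esub> inv\<^bsub>G\<^esub> y})"

text \<open>Class exactly \<open>c\<close>; the trivial group has class 0.\<close>

definition nilpotent_of_class :: "('a, 'b) monoid_scheme \<Rightarrow> nat \<Rightarrow> bool" where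
  "nilpotent_of_class G c \<longleftrightarrow>
     group G \<and> lower_central G c = {\<one>\<^bsub>G\<^esub>} \<and> (\<forall>d<c. lower_central G d \<noteq> {\<one>\<^bsub>G\<^esub>})"

text \<open>For \<open>ts = [(e1, u1), \<dots>, (em, um)]\<close> this is the product \<open>u0 x^e1 u1 \<dots> x^em um\<close>.\<close>

definition word_map :: "('a, 'b) monoid_scheme \<Rightarrow> 'a \<Rightarrow> (int \<times> 'a) list \<Rightarrow> 'a \<Rightarrow> 'a" where
  "word_map G u0 ts x = foldl (\<lambda>a (e, u). a \<otimes>\<^bsub>G\<^esub> x [^]\<^bsub>G\<^esub> e \<otimes>\<^bsub>G\<^esub> u) u0 ts"

text \<open>The library represents automorphisms (\<open>auto G\<close>) by functions that are
  \<open>undefined\<close> outside \<open>carrier G\<close>, so equality with a word map is only required on the carrier.\<close>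

definition polynomial_automorphism :: "('a, 'b) monoid_scheme \<Rightarrow> ('a \<Rightarrow> 'a) \<Rightarrow> bool" where
  "polynomial_automorphism G f \<longleftrightarrow>
     f \<in> auto G \<and>
     (\<exists>u0 \<in> carrier G. \<exists>ts. snd ` set ts \<subseteq> carrier G \<and>
        (\<forall>x \<in> carrier G. f x = word_map G u0 ts x))"

definition PolyAut :: "('a, 'b) monoid_scheme \<Rightarrow> ('a \<Rightarrow> 'a) monoid" where
  "PolyAut G = subgroup_generated (AutoGroup G) {f. polynomial_automorphism G f}"

end

theory Submission
  imports Defs
begin

text \<open>An automorphism \<open>a\<close> that moves every element by a factor central modulo a characteristic subgroup
  \<open>N\<close> commutes modulo \<open>N\<close> with every polynomial automorphism \<open>f\<close>: applying \<open>a\<close> to the word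
  defining \<open>f\<close> multiplies the coefficients by central factors, whose product is trivial because both
  maps fix \<open>\<one>\<close>. Polynomial automorphisms are themselves of this kind modulo the third term of the lower
  central series, so each further term of the lower central series of \<open>P(G)\<close> acts trivially modulo one
  more term of that of \<open>G\<close>. This bounds the class by \<open>k - 1\<close>. Conversely, \<open>P(G)\<close> contains the
  inner automorphisms, which form a group of class \<open>k - 1\<close>.\<close>

section \<open>Commutators, and centrality and triviality modulo a subgroup\<close>

definition commutator :: "('a, 'b) monoid_scheme \<Rightarrow> 'a \<Rightarrow> 'a \<Rightarrow> 'a" where
  "commutator G x y = x \<otimes>\<^bsub>G\<^esub> y \<otimes>\<^bsub>G\<^esub> inv\<^bsub>G\<^esub> x \<otimes>\<^bsub>G\<^esub> inv\<^bsub>G\<^esub> y"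

text \<open>For normal \<open>N\<close> this is the preimage in \<open>G\<close> of the centre of
  \<open>G Mod N\<close>.\<close>

definition central_mod :: "('a, 'b) monoid_scheme \<Rightarrow> 'a set \<Rightarrow> 'a set" where
  "central_mod G N = {z \<in> carrier G. \<forall>y \<in> carrier G. commutator G z y \<in> N}"

text \<open>For a characteristic subgroup \<open>M\<close> this is the kernel of the action of
  \<open>auto G\<close> on \<open>G Mod M\<close>.\<close>

definition trivial_mod :: "('a, 'b) monoid_scheme \<Rightarrow> 'a set \<Rightarrow> ('a \<Rightarrow> 'a) set" where
  "trivial_mod G M = {f \<in> auto G. \<forall>x \<in> carrier G. f x \<otimes>\<^bsub>G\<^esub> inv\<^bsub>G\<^esub> x \<in> M}"

context group
begin

lemma inv_mult_cancel [simp]: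
  assumes "x \<in> carrier G" "y \<in> carrier G"
  shows "x \<otimes> y \<otimes> inv y = x" "x \<otimes> inv y \<otimes> y = x"
    "x \<otimes> (inv x \<otimes> y) = y" "inv x \<otimes> (x \<otimes> y) = y"
  using assms by (simp_all add: m_assoc) (simp_all flip: m_assoc)

lemma commutator_closed [simp]:
  "x \<in> carrier G \<Longrightarrow> y \<in> carrier G \<Longrightarrow> commutator G x y \<in> carrier G"
  by (simp add: commutator_def)

lemma commutator_eq_one_iff:
  assumes "x \<in> carrier G" "y \<in> carrier G"
  shows "commutator G x y = \<one> \<longleftrightarrow> x \<otimes> y = y \<otimes> x"
proof -
  have "commutator G x y = x \<otimes> y \<otimes> inv (y \<otimes> x)"
    using assms by (simp add: commutator_def inv_mult_group m_assoc)
  then show ?thesis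
    using assms by (metis inv_equality inv_inv m_closed inv_closed r_inv)
qed

lemma inv_commutator:
  "x \<in> carrier G \<Longrightarrow> y \<in> carrier G \<Longrightarrow> inv (commutator G x y) = commutator G y x"
  by (simp add: commutator_def inv_mult_group m_assoc)

lemma subgroup_lower_central: "subgroup (lower_central G n) G"
proof (induction n)
  case (Suc n)
  then show ?case
    unfolding lower_central.simps
    by (intro generate_is_subgroup) (auto dest: subgroup.mem_carrier)
qed (simp add: subgroup_self)

end

section \<open>Commutation modulo the kernel of a homomorphism\<close>

context group_hom
begin

lemma hom_commutator:
  "x \<in> carrier G \<Longrightarrow> y \<in> carrier G \<Longrightarrow> h (commutator G x y) = commutator H (h x) (h y)"
  by (simp add: commutator_def)

lemma commutator_in_kernel_iff:
  "x \<in> carrier G \<Longrightarrow> y \<in> carrier G \<Longrightarrow>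
    commutator G x y \<in> kernel G H h \<longleftrightarrow> h x \<otimes>\<^bsub>H\<^esub> h y = h y \<otimes>\<^bsub>H\<^esub> h x"
  by (simp add: kernel_def hom_commutator H.commutator_eq_one_iff)

lemma quotient_in_kernel_iff:
  assumes "x \<in> carrier G" "y \<in> carrier G"
  shows "x \<otimes> inv y \<in> kernel G H h \<longleftrightarrow> h x = h y"
  using assms by (simp add: kernel_def)
    (metis H.inv_mult_cancel(2) H.l_one H.r_inv hom_closed)

text \<open>This is the preimage under \<open>h\<close> of the centralizer of \<open>h y\<close>. It
  serves to extend commutation from an element to its powers and, through quotient maps, from
  generators to the group they generate.\<close>

lemma subgroup_centralizer_mod_kernel:
  assumes y: "y \<in> carrier G"
  shows "subgroup {x \<in> carrier G. commutator G x y \<in> kernel G H h} G"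
proof (rule G.subgroupI)
  fix a assume a: "a \<in> {x \<in> carrier G. commutator G x y \<in> kernel G H h}"
  then have "h a \<otimes>\<^bsub>H\<^esub> h y = h y \<otimes>\<^bsub>H\<^esub> h a"
    using y by (auto simp: commutator_in_kernel_iff)
  then have "inv\<^bsub>H\<^esub> (h a) \<otimes>\<^bsub>H\<^esub> h y = h y \<otimes>\<^bsub>H\<^esub> inv\<^bsub>H\<^esub> (h a)"
    using a y by (metis (no_types, lifting) H.inv_closed H.inv_mult_cancel(1) H.inv_mult_cancel(4)
        H.m_assoc H.m_closed hom_closed mem_Collect_eq)
  then show "inv a \<in> {x \<in> carrier G. commutator G x y \<in> kernel G H h}"
    using a y by (simp add: commutator_in_kernel_iff)
next
  fix a b
  assume a: "a \<in> {x \<in> carrier G. commutator G x y \<in> kernel G H h}"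
    and b: "b \<in> {x \<in> carrier G. commutator G x y \<in> kernel G H h}"
  have "h a \<otimes>\<^bsub>H\<^esub> h b \<otimes>\<^bsub>H\<^esub> h y = h a \<otimes>\<^bsub>H\<^esub> h y \<otimes>\<^bsub>H\<^esub> h b"
    using a b y by (auto simp: commutator_in_kernel_iff H.m_assoc)
  also have "\<dots> = h y \<otimes>\<^bsub>H\<^esub> (h a \<otimes>\<^bsub>H\<^esub> h b)"
  proof -
    have "h a \<otimes>\<^bsub>H\<^esub> h y = h y \<otimes>\<^bsub>H\<^esub> h a"
      using a y by (auto simp: commutator_in_kernel_iff)
    then show ?thesis using a b y by (auto simp: H.m_assoc)
  qed
  finally show "a \<otimes> b \<in> {x \<in> carrier G. commutator G x y \<in> kernel G H h}"
    using a b y by (simp add: commutator_in_kernel_iff)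
next
  have "\<one> \<in> {x \<in> carrier G. commutator G x y \<in> kernel G H h}"
    using y by (simp add: commutator_in_kernel_iff)
  then show "{x \<in> carrier G. commutator G x y \<in> kernel G H h} \<noteq> {}" by blast
qed auto

text \<open>Commutators go to commutators, so the generators of each term go into the matching term
  of \<open>H\<close>. With \<open>H = G\<close> this makes the terms stable under automorphisms and
  conjugation; applied to the map from \<open>G\<close> to its inner automorphisms it gives the
  lower bound on the class.\<close>

lemma hom_lower_central: "x \<in> lower_central G n \<Longrightarrow> h x \<in> lower_central H n"
proof (induction n arbitrary: x)
  case (Suc n)
  have sub: "lower_central G n \<subseteq> carrier G"
    by (rule subgroup.subset [OF G.subgroup_lower_central])
  have "h x \<in> h ` lower_central G (Suc n)"
    using Suc.prems by blast
  also have "\<dots> = generate H (h ` (\<Union>x \<in> lower_central G n. \<Union>y \<in> carrier G.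
      {x \<otimes> y \<otimes> inv x \<otimes> inv y}))"
    unfolding lower_central.simps using sub by (intro generate_img [symmetric]) auto
  also have "\<dots> \<subseteq> lower_central H (Suc n)"
    unfolding lower_central.simps using sub Suc.IH
    by (intro H.mono_generate) (fastforce simp: subset_iff)
  finally show ?case .
qed simp

end

text \<open>Results about kernels become results modulo an arbitrary normal subgroup once
  \<open>h\<close> is taken to be the coset map.\<close>

lemma (in normal) kernel_r_coset: "kernel G (G Mod H) ((#>) H) = H"
proof -
  have "H #> x = H \<longleftrightarrow> x \<in> H" if "x \<in> carrier G" for x
    using that by (metis is_subgroup rcos_self coset_join2 subgroup_axioms)
  then show ?thesis
    using subset by (auto simp: kernel_def FactGroup_def)
qed

lemma (in normal) group_hom_r_coset: "group_hom G (G Mod H) ((#>) H)"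
  by (simp add: group_hom_def group_hom_axioms_def is_group factorgroup_is_group r_coset_hom_Mod)

section \<open>Normal subgroups and the lower central series\<close>

context group
begin

lemma subgroup_centralizer_mod:
  assumes "N \<lhd> G" "y \<in> carrier G"
  shows "subgroup {x \<in> carrier G. commutator G x y \<in> N} G"
  using group_hom.subgroup_centralizer_mod_kernel [OF normal.group_hom_r_coset [OF assms(1)] assms(2)]
  by (simp add: normal.kernel_r_coset [OF assms(1)])

lemma subgroup_central_mod:
  assumes "N \<lhd> G"
  shows "subgroup (central_mod G N) G"
proof -
  have "central_mod G N = (\<Inter>y \<in> carrier G. {x \<in> carrier G. commutator G x y \<in> N})"
    by (auto simp: central_mod_def)
  also have "subgroup \<dots> G"
    by (rule subgroups_Inter) (use subgroup_centralizer_mod [OF assms] in auto)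
  finally show ?thesis .
qed

lemma commutator_lower_central:
  "x \<in> lower_central G n \<Longrightarrow> y \<in> carrier G \<Longrightarrow> commutator G x y \<in> lower_central G (Suc n)"
  unfolding lower_central.simps commutator_def by (rule generate.incl) blast

lemma conjugation_hom:
  assumes g: "g \<in> carrier G"
  shows "group_hom G G (\<lambda>x. g \<otimes> x \<otimes> inv g)"
proof
  show "(\<lambda>x. g \<otimes> x \<otimes> inv g) \<in> hom G G"
    by (rule homI) (simp_all add: g m_assoc)
qed

lemma normal_lower_central: "lower_central G n \<lhd> G"
  unfolding normal_inv_iff
  using group_hom.hom_lower_central [OF conjugation_hom] by (auto simp: subgroup_lower_central)

lemma lower_central_subset_central_mod:
  "lower_central G n \<subseteq> central_mod G (lower_central G (Suc n))"
  using subgroup.mem_carrier [OF subgroup_lower_central] commutator_lower_central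
  by (auto simp: central_mod_def simp del: lower_central.simps)

section \<open>Automorphisms and the operations of \<open>AutoGroup G\<close>\<close>

lemma group_hom_auto: "f \<in> auto G \<Longrightarrow> group_hom G G f"
  by unfold_locales (auto simp: auto_def)

lemma auto_closed [simp]: "f \<in> auto G \<Longrightarrow> x \<in> carrier G \<Longrightarrow> f x \<in> carrier G"
  by (rule group_hom.hom_closed [OF group_hom_auto])

lemma auto_surj:
  assumes "f \<in> auto G" "y \<in> carrier G"
  obtains x where "x \<in> carrier G" "y = f x"
proof -
  have "f ` carrier G = carrier G"
    using assms(1) by (simp add: auto_def Bij_def bij_betw_def)
  then have "y \<in> f ` carrier G" using assms(2) by simp
  then show thesis using that by (rule imageE)
qed

lemma auto_eqI:
  "f \<in> auto G \<Longrightarrow> g \<in> auto G \<Longrightarrow> (\<And>x. x \<in> carrier G \<Longrightarrow> f x = g x) \<Longrightarrow> f = g"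
  by (rule extensionalityI [where A = "carrier G"]) (auto simp: auto_def Bij_imp_extensional)

lemma carrier_AutoGroup [simp]: "carrier (AutoGroup G) = auto G"
  by (simp add: AutoGroup_def)

lemma AutoGroup_mult_apply:
  "f \<in> auto G \<Longrightarrow> g \<in> auto G \<Longrightarrow> x \<in> carrier G \<Longrightarrow> (f \<otimes>\<^bsub>AutoGroup G\<^esub> g) x = f (g x)"
  by (simp add: AutoGroup_def BijGroup_def auto_def compose_def)

lemma AutoGroup_one_apply: "x \<in> carrier G \<Longrightarrow> \<one>\<^bsub>AutoGroup G\<^esub> x = x"
  by (simp add: AutoGroup_def BijGroup_def)

lemma AutoGroup_inv_closed [simp]: "f \<in> auto G \<Longrightarrow> inv\<^bsub>AutoGroup G\<^esub> f \<in> auto G"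
  using group.inv_closed [OF AutoGroup] by simp

lemma AutoGroup_mult_closed [simp]:
  "f \<in> auto G \<Longrightarrow> g \<in> auto G \<Longrightarrow> f \<otimes>\<^bsub>AutoGroup G\<^esub> g \<in> auto G"
  using monoid.m_closed [OF group.is_monoid [OF AutoGroup]] by simp

lemma AutoGroup_inv_apply:
  assumes "f \<in> auto G" "x \<in> carrier G"
  shows "(inv\<^bsub>AutoGroup G\<^esub> f) (f x) = x" "f ((inv\<^bsub>AutoGroup G\<^esub> f) x) = x"
  using assms group.l_inv [OF AutoGroup] group.r_inv [OF AutoGroup]
  by (simp_all add: AutoGroup_one_apply flip: AutoGroup_mult_apply)

text \<open>Surjectivity of \<open>f\<close> enters here: a test element \<open>y\<close> is some
  \<open>f w\<close>, and the commutator of \<open>f z\<close> and \<open>f w\<close> is the image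
  of the commutator of \<open>z\<close> and \<open>w\<close>, hence in \<open>N\<close>.\<close>

lemma auto_central_mod:
  assumes f: "f \<in> auto G" and N: "f ` N \<subseteq> N"
  shows "f ` central_mod G N \<subseteq> central_mod G N"
proof (rule image_subsetI)
  fix z assume z: "z \<in> central_mod G N"
  interpret f: group_hom G G f by (rule group_hom_auto [OF f])
  have zc: "z \<in> carrier G" using z by (simp add: central_mod_def)
  have "commutator G (f z) y \<in> N" if y: "y \<in> carrier G" for y
  proof -
    obtain w where w: "w \<in> carrier G" "y = f w"
      by (rule auto_surj [OF f y])
    have "f (commutator G z w) \<in> N"
      using z w(1) N by (auto simp: central_mod_def)
    then show ?thesis
      using zc w by (simp add: f.hom_commutator)
  qed
  then show "f z \<in> central_mod G N"
    using zc by (simp add: central_mod_def)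
qed

lemma auto_lower_central: "f \<in> auto G \<Longrightarrow> f ` lower_central G n \<subseteq> lower_central G n"
  using group_hom.hom_lower_central [OF group_hom_auto] by blast

section \<open>Automorphisms acting trivially modulo a characteristic subgroup\<close>

lemma subgroup_trivial_mod:
  assumes M: "subgroup M G" and inv: "\<And>f. f \<in> auto G \<Longrightarrow> f ` M \<subseteq> M"
  shows "subgroup (trivial_mod G M) (AutoGroup G)"
proof (rule group.subgroupI [OF AutoGroup])
  show "trivial_mod G M \<subseteq> carrier (AutoGroup G)" by (auto simp: trivial_mod_def)
  have "\<one>\<^bsub>AutoGroup G\<^esub> \<in> trivial_mod G M"
    using M AutoGroup_one_apply group.is_monoid [OF AutoGroup] monoid.one_closed
    by (fastforce simp: trivial_mod_def subgroup.one_closed)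
  then show "trivial_mod G M \<noteq> {}" by blast
next
  fix f assume f: "f \<in> trivial_mod G M"
  then have fa: "f \<in> auto G" by (simp add: trivial_mod_def)
  let ?g = "inv\<^bsub>AutoGroup G\<^esub> f"
  interpret g: group_hom G G ?g by (rule group_hom_auto) (simp add: fa)
  have "?g x \<otimes> inv x \<in> M" if x: "x \<in> carrier G" for x
  proof -
    \<comment> \<open>The inverse of \<open>f x \<otimes> inv x\<close> is in \<open>M\<close>;
      applying \<open>?g\<close>, which preserves \<open>M\<close>, turns \<open>f x\<close> back
      into \<open>x\<close>.\<close>
    have "?g (inv (f x \<otimes> inv x)) \<in> M"
      using f x fa
      by (intro subsetD [OF inv [of ?g] imageI] subgroup.m_inv_closed [OF M]) (auto simp: trivial_mod_def)
    also have "?g (inv (f x \<otimes> inv x)) = ?g x \<otimes> inv x"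
      using x fa by (simp add: inv_mult_group AutoGroup_inv_apply)
    finally show ?thesis .
  qed
  then show "?g \<in> trivial_mod G M" using fa by (simp add: trivial_mod_def)
next
  fix f g assume f: "f \<in> trivial_mod G M" and g: "g \<in> trivial_mod G M"
  then have fa: "f \<in> auto G" and ga: "g \<in> auto G" by (simp_all add: trivial_mod_def)
  interpret f: group_hom G G f by (rule group_hom_auto) (simp add: fa)
  have "f (g x) \<otimes> inv x \<in> M" if x: "x \<in> carrier G" for x
  proof -
    \<comment> \<open>The displacement of \<open>x\<close> under the product is the
      \<open>f\<close>-image of its displacement under \<open>g\<close>, times its displacement
      under \<open>f\<close>.\<close>
    have "f (g x \<otimes> inv x) \<in> M"
      using g x by (intro subsetD [OF inv [OF fa] imageI]) (simp add: trivial_mod_def)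
    moreover have "f x \<otimes> inv x \<in> M"
      using f x by (simp add: trivial_mod_def)
    ultimately have "f (g x \<otimes> inv x) \<otimes> (f x \<otimes> inv x) \<in> M"
      by (rule subgroup.m_closed [OF M])
    also have "f (g x \<otimes> inv x) \<otimes> (f x \<otimes> inv x) = f (g x) \<otimes> inv x"
      using x fa ga by (simp add: m_assoc)
    finally show ?thesis .
  qed
  then show "f \<otimes>\<^bsub>AutoGroup G\<^esub> g \<in> trivial_mod G M"
    using fa ga by (simp add: trivial_mod_def AutoGroup_mult_apply)
qed

lemma normal_trivial_mod:
  assumes M: "subgroup M G" and inv: "\<And>f. f \<in> auto G \<Longrightarrow> f ` M \<subseteq> M"
  shows "trivial_mod G M \<lhd> AutoGroup G"
  unfolding group.normal_inv_iff [OF AutoGroup]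
proof (intro conjI ballI subgroup_trivial_mod M inv)
  fix f t assume f: "f \<in> carrier (AutoGroup G)" and t: "t \<in> trivial_mod G M"
  then have fa: "f \<in> auto G" and ta: "t \<in> auto G" by (simp_all add: trivial_mod_def)
  interpret f: group_hom G G f by (rule group_hom_auto) (simp add: fa)
  have "f (t ((inv\<^bsub>AutoGroup G\<^esub> f) x)) \<otimes> inv x \<in> M" if x: "x \<in> carrier G" for x
  proof -
    \<comment> \<open>Since \<open>x = f w\<close>, the conjugate of \<open>t\<close> sends
      \<open>x\<close> to \<open>f (t w)\<close>, and the displacement is the \<open>f\<close>-image
      of that of \<open>w\<close> under \<open>t\<close>.\<close>
    define w where "w = (inv\<^bsub>AutoGroup G\<^esub> f) x"
    have w: "w \<in> carrier G" "x = f w"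
      using fa x by (simp_all add: w_def AutoGroup_inv_apply)
    have "f (t w \<otimes> inv w) \<in> M"
      using t w by (intro subsetD [OF inv [OF fa] imageI]) (auto simp: trivial_mod_def)
    also have "f (t w \<otimes> inv w) = f (t w) \<otimes> inv x"
      using w ta by simp
    finally show ?thesis by (simp add: w_def)
  qed
  then show "f \<otimes>\<^bsub>AutoGroup G\<^esub> t \<otimes>\<^bsub>AutoGroup G\<^esub> inv\<^bsub>AutoGroup G\<^esub> f \<in> trivial_mod G M"
    using fa ta by (simp add: trivial_mod_def AutoGroup_mult_apply)
qed

text \<open>The hypothesis is evaluated at the point that \<open>f\<close> and then \<open>g\<close>
  carry to \<open>x\<close>; there it measures how far the commutator moves
  \<open>x\<close>.\<close>

lemma commutator_in_trivial_mod:
  assumes fa: "f \<in> auto G" and ga: "g \<in> auto G"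
    and comm: "\<And>x. x \<in> carrier G \<Longrightarrow> f (g x) \<otimes> inv (g (f x)) \<in> M"
  shows "commutator (AutoGroup G) f g \<in> trivial_mod G M"
proof -
  have "f (g ((inv\<^bsub>AutoGroup G\<^esub> f) ((inv\<^bsub>AutoGroup G\<^esub> g) x))) \<otimes> inv x \<in> M" if "x \<in> carrier G" for x
    using comm [of "(inv\<^bsub>AutoGroup G\<^esub> f) ((inv\<^bsub>AutoGroup G\<^esub> g) x)"] that fa ga
    by (simp add: AutoGroup_inv_apply)
  then show ?thesis
    using fa ga by (simp add: commutator_def trivial_mod_def AutoGroup_mult_apply)
qed

section \<open>Word maps and homomorphisms\<close>

lemma word_map_snoc:
  "word_map G u0 (ts @ [(e, u)]) x = word_map G u0 ts x \<otimes> x [^] e \<otimes> u"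
  by (simp add: word_map_def)

lemma word_map_closed [simp]:
  "u0 \<in> carrier G \<Longrightarrow> snd ` set ts \<subseteq> carrier G \<Longrightarrow> x \<in> carrier G \<Longrightarrow> word_map G u0 ts x \<in> carrier G"
  by (induction ts rule: rev_induct) (auto simp: word_map_snoc simp: word_map_def)

end

context group_hom
begin

text \<open>Since \<open>h x\<close> commutes with the image of \<open>h\<close>, all powers of
  \<open>x\<close> can be collected on the right, where their exponents add up. What remains is the
  product of the coefficients, that is, the value of the word at \<open>\<one>\<close>.\<close>

lemma hom_word_map_central:
  assumes u0: "u0 \<in> carrier G" and ts: "snd ` set ts \<subseteq> carrier G" and x: "x \<in> carrier G"
    and cent: "\<And>y. y \<in> carrier G \<Longrightarrow> h x \<otimes>\<^bsub>H\<^esub> h y = h y \<otimes>\<^bsub>H\<^esub> h x"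
  shows "h (word_map G u0 ts x)
    = h (word_map G u0 ts \<one>) \<otimes>\<^bsub>H\<^esub> h x [^]\<^bsub>H\<^esub> (\<Sum>t\<leftarrow>ts. fst t)"
  using ts
proof (induction ts rule: rev_induct)
  case Nil
  then show ?case using u0 by (simp add: word_map_def)
next
  case (snoc t ts)
  obtain e u where t: "t = (e, u)" by fastforce
  let ?s = "\<Sum>t\<leftarrow>ts. fst t"
  have u: "u \<in> carrier G" and ts: "snd ` set ts \<subseteq> carrier G"
    using snoc.prems by (auto simp: t)
  have c: "h u \<otimes>\<^bsub>H\<^esub> h (x [^] n) = h (x [^] n) \<otimes>\<^bsub>H\<^esub> h u" for n :: int
  proof -
    \<comment> \<open>The elements commuting with \<open>u\<close> modulo the kernel form a
      subgroup; with \<open>x\<close> it contains all powers of \<open>x\<close>, negative ones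
      included.\<close>
    have "subgroup {a \<in> carrier G. commutator G a u \<in> kernel G H h} G"
      by (rule subgroup_centralizer_mod_kernel [OF u])
    moreover have "x \<in> {a \<in> carrier G. commutator G a u \<in> kernel G H h}"
      using x u cent by (simp add: commutator_in_kernel_iff)
    ultimately have "x [^] n \<in> {a \<in> carrier G. commutator G a u \<in> kernel G H h}"
      by (metis G.subgroup_int_pow_closed)
    then show ?thesis using x u by (simp add: commutator_in_kernel_iff)
  qed
  have "h (word_map G u0 (ts @ [t]) x)
    = h (word_map G u0 ts \<one>) \<otimes>\<^bsub>H\<^esub> h x [^]\<^bsub>H\<^esub> ?s \<otimes>\<^bsub>H\<^esub> h x [^]\<^bsub>H\<^esub> e \<otimes>\<^bsub>H\<^esub> h u"
    using snoc.IH ts u u0 x by (simp add: t G.word_map_snoc hom_int_pow)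
  also have "\<dots> = h (word_map G u0 ts \<one>) \<otimes>\<^bsub>H\<^esub> (h (x [^] (?s + e)) \<otimes>\<^bsub>H\<^esub> h u)"
    using ts u u0 x by (simp add: hom_int_pow H.int_pow_mult H.m_assoc)
  also have "\<dots> = h (word_map G u0 (ts @ [t]) \<one>) \<otimes>\<^bsub>H\<^esub> h x [^]\<^bsub>H\<^esub> (?s + e)"
    \<comment> \<open>Read from right to left, \<open>c\<close> moves \<open>h u\<close> in front of
      the power, where it completes the product of the coefficients.\<close>
    unfolding c [symmetric]
    using ts u u0 x by (simp add: t G.word_map_snoc H.m_assoc hom_int_pow)
  finally show ?case by (simp add: t)
qed

text \<open>Under \<open>a\<close> each coefficient gains a left factor that is central modulo the
  kernel. These factors move to the front, and \<open>z\<close> is their product. It is chosen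
  before \<open>x\<close>, which later permits evaluation at \<open>\<one>\<close>.\<close>

lemma hom_word_map_perturb:
  assumes a: "a \<in> auto G"
    and cent: "\<And>x. x \<in> carrier G \<Longrightarrow> a x \<otimes> inv x \<in> central_mod G (kernel G H h)"
    and u0: "u0 \<in> carrier G" and ts: "snd ` set ts \<subseteq> carrier G"
  shows "\<exists>z \<in> central_mod G (kernel G H h). \<forall>x \<in> carrier G.
    h (a (word_map G u0 ts x)) = h z \<otimes>\<^bsub>H\<^esub> h (word_map G u0 ts (a x))"
  using ts
proof (induction ts rule: rev_induct)
  case Nil
  show ?case
    using u0 a cent [OF u0] by (intro bexI [of _ "a u0 \<otimes> inv u0"]) (simp_all add: word_map_def)
next
  case (snoc t ts)
  interpret a: group_hom G G a by (rule G.group_hom_auto [OF a])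
  obtain e u where t: "t = (e, u)" by fastforce
  have u: "u \<in> carrier G" and ts: "snd ` set ts \<subseteq> carrier G"
    using snoc.prems by (auto simp: t)
  obtain z where z: "z \<in> central_mod G (kernel G H h)" and
    eq: "\<And>x. x \<in> carrier G \<Longrightarrow> h (a (word_map G u0 ts x)) = h z \<otimes>\<^bsub>H\<^esub> h (word_map G u0 ts (a x))"
    using snoc.IH ts by blast
  define c where "c = a u \<otimes> inv u"
  have c: "c \<in> central_mod G (kernel G H h)" and au: "a u = c \<otimes> u"
    using cent [OF u] u by (simp_all add: c_def)
  have cc: "c \<in> carrier G" "z \<in> carrier G" using c z by (auto simp: central_mod_def)
  have comm: "h w \<otimes>\<^bsub>H\<^esub> h c = h c \<otimes>\<^bsub>H\<^esub> h w" if "w \<in> carrier G" for w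
    using c that by (auto simp: central_mod_def commutator_in_kernel_iff)
  have "z \<otimes> c \<in> central_mod G (kernel G H h)"
    using z c G.subgroup_central_mod [OF normal_kernel] by (metis subgroup.m_closed)
  moreover have "h (a (word_map G u0 (ts @ [t]) x))
      = h (z \<otimes> c) \<otimes>\<^bsub>H\<^esub> h (word_map G u0 (ts @ [t]) (a x))" if x: "x \<in> carrier G" for x
  proof -
    let ?w = "word_map G u0 ts (a x)"
    have w: "?w \<in> carrier G" using x u0 ts by simp
    have "h (a (word_map G u0 (ts @ [t]) x))
      = h z \<otimes>\<^bsub>H\<^esub> (h (?w \<otimes> a x [^] e) \<otimes>\<^bsub>H\<^esub> h c) \<otimes>\<^bsub>H\<^esub> h u"
      using x u0 ts u cc w
      by (simp add: t G.word_map_snoc au eq a.hom_int_pow H.m_assoc)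
    \<comment> \<open>Here \<open>comm\<close> carries \<open>h c\<close> leftwards past the word so
      that it joins \<open>h z\<close>.\<close>
    also have "\<dots> = h (z \<otimes> c) \<otimes>\<^bsub>H\<^esub> h (word_map G u0 (ts @ [t]) (a x))"
      using x u0 ts u cc w by (subst comm) (simp_all add: t G.word_map_snoc H.m_assoc)
    finally show ?thesis .
  qed
  ultimately show ?case by blast
qed

text \<open>The perturbation \<open>h z\<close> of the coefficients does not depend on the argument, so it is read off at \<open>\<one>\<close>.\<close>

lemma polynomial_automorphism_commutes_mod_kernel:
  assumes a: "a \<in> auto G"
    and cent: "\<And>x. x \<in> carrier G \<Longrightarrow> a x \<otimes> inv x \<in> central_mod G (kernel G H h)"
    and f: "polynomial_automorphism G f" and x: "x \<in> carrier G"
  shows "h (a (f x)) = h (f (a x))"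
proof -
  obtain u0 ts where fa: "f \<in> auto G" and u0: "u0 \<in> carrier G" and ts: "snd ` set ts \<subseteq> carrier G"
    and f_eq: "\<And>x. x \<in> carrier G \<Longrightarrow> f x = word_map G u0 ts x"
    using f by (auto simp: polynomial_automorphism_def)
  obtain z where z: "z \<in> central_mod G (kernel G H h)"
    and eq: "\<And>x. x \<in> carrier G \<Longrightarrow> h (a (f x)) = h z \<otimes>\<^bsub>H\<^esub> h (f (a x))"
    using hom_word_map_perturb [OF a cent u0 ts] a by (auto simp: f_eq)
  have "a \<one> = \<one>" "f \<one> = \<one>"
    using group_hom.hom_one [OF G.group_hom_auto] a fa by blast+
  then have "h z = \<one>\<^bsub>H\<^esub>"
    using eq [of \<one>] z by (simp add: central_mod_def)
  then show ?thesis using eq x a fa by simp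
qed

end

section \<open>Polynomial automorphisms modulo the third term of the lower central series\<close>

context group
begin

text \<open>As \<open>f\<close> fixes \<open>\<one>\<close>, the product of the coefficients is
  trivial and only the exponent sum \<open>e\<close> is left. One \<open>e\<close> has to serve all
  \<open>h\<close>, since it is applied both to a quotient map and to the maps given by commutators
  with a fixed \<open>y\<close>.\<close>

lemma polynomial_automorphism_power:
  fixes H :: "('c, 'd) monoid_scheme"
  assumes "polynomial_automorphism G f"
  shows "\<exists>e :: int. \<forall>h. group_hom G H h \<longrightarrow> (\<forall>x \<in> carrier G.
    (\<forall>y \<in> carrier G. h x \<otimes>\<^bsub>H\<^esub> h y = h y \<otimes>\<^bsub>H\<^esub> h x) \<longrightarrow> h (f x) = h x [^]\<^bsub>H\<^esub> e)"
proof -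
  obtain u0 ts where f: "f \<in> auto G" and u0: "u0 \<in> carrier G" and ts: "snd ` set ts \<subseteq> carrier G"
    and eq: "\<And>x. x \<in> carrier G \<Longrightarrow> f x = word_map G u0 ts x"
    using assms by (auto simp: polynomial_automorphism_def)
  have "f \<one> = \<one>"
    by (rule group_hom.hom_one [OF group_hom_auto [OF f]])
  then have one: "word_map G u0 ts \<one> = \<one>"
    using eq by simp
  show ?thesis
  proof (intro exI [of _ "\<Sum>t\<leftarrow>ts. fst t"] allI impI ballI)
    fix h x
    assume "group_hom G H h" and x: "x \<in> carrier G"
      and cent: "\<forall>y \<in> carrier G. h x \<otimes>\<^bsub>H\<^esub> h y = h y \<otimes>\<^bsub>H\<^esub> h x"
    then interpret k: group_hom G H h by simp
    show "h (f x) = h x [^]\<^bsub>H\<^esub> (\<Sum>t\<leftarrow>ts. fst t)"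
      using k.hom_word_map_central [OF u0 ts x] cent x by (simp add: eq one)
  qed
qed

text \<open>In general the commutator of \<open>b\<close> and \<open>y\<close> appears conjugated by
  \<open>a\<close>; the hypothesis \<open>c\<close> removes this conjugation.\<close>

lemma commutator_mult_left:
  assumes "a \<in> carrier G" "b \<in> carrier G" "y \<in> carrier G"
    and c: "commutator G b y \<otimes> a = a \<otimes> commutator G b y"
  shows "commutator G (a \<otimes> b) y = commutator G b y \<otimes> commutator G a y"
proof -
  have "commutator G (a \<otimes> b) y = a \<otimes> commutator G b y \<otimes> (y \<otimes> inv a \<otimes> inv y)"
    using assms(1-3) by (simp add: commutator_def inv_mult_group m_assoc)
  also have "\<dots> = commutator G b y \<otimes> commutator G a y"
    unfolding c [symmetric] using assms(1-3) by (simp add: commutator_def m_assoc)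
  finally show ?thesis .
qed

text \<open>Cancelling \<open>x\<close> shows that \<open>y\<close> and \<open>w\<close> conjugate
  \<open>x\<close> to the same element, so \<open>w \<otimes> inv y\<close> centralizes that
  element. As \<open>x\<close> runs through the group, so does its conjugate by
  \<open>y\<close>.\<close>

lemma commutator_eq_imp_commute:
  assumes "x \<in> carrier G" "y \<in> carrier G" "w \<in> carrier G"
    and "commutator G x y = commutator G x w"
  shows "w \<otimes> inv y \<otimes> (y \<otimes> x \<otimes> inv y) = y \<otimes> x \<otimes> inv y \<otimes> (w \<otimes> inv y)"
proof -
  have "y \<otimes> inv x \<otimes> inv y = w \<otimes> inv x \<otimes> inv w"
    using assms by (simp add: commutator_def m_assoc)
  then have "inv (y \<otimes> inv x \<otimes> inv y) = inv (w \<otimes> inv x \<otimes> inv w)" by simp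
  then have "y \<otimes> x \<otimes> inv y = w \<otimes> x \<otimes> inv w"
    using assms(1-3) by (simp add: inv_mult_group m_assoc)
  then have "y \<otimes> x \<otimes> inv y \<otimes> (w \<otimes> inv y) = w \<otimes> x \<otimes> inv w \<otimes> (w \<otimes> inv y)" by simp
  then show ?thesis
    using assms(1-3) by (simp add: m_assoc)
qed

text \<open>Modulo the third term of the lower central series the commutator is bilinear, and \<open>f\<close> raises
  central elements to a fixed power \<open>e\<close>. Hence \<open>[f x, y] = [x, y]\<^sup>e = f [x, y] = [f x, f y]\<close>, so
  \<open>y\<close> and \<open>f y\<close> differ by an element commuting with everything.\<close>

lemma polynomial_automorphism_central:
  assumes f: "polynomial_automorphism G f"
  shows "f \<in> trivial_mod G (central_mod G (lower_central G 2))"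
proof -
  let ?N = "lower_central G 2" and ?Q = "G Mod lower_central G 2"
  define p where "p = (#>) ?N"
  interpret N: normal ?N G by (rule normal_lower_central)
  interpret p: group_hom G ?Q p unfolding p_def by (rule N.group_hom_r_coset)
  have ker: "kernel G ?Q p = ?N" unfolding p_def by (rule N.kernel_r_coset)
  have fa: "f \<in> auto G" using f by (simp add: polynomial_automorphism_def)
  interpret f: group_hom G G f by (rule group_hom_auto [OF fa])
  have cent: "p (commutator G x y) \<otimes>\<^bsub>?Q\<^esub> p b = p b \<otimes>\<^bsub>?Q\<^esub> p (commutator G x y)"
    if "x \<in> carrier G" "y \<in> carrier G" "b \<in> carrier G" for x y b
  proof -
    have "commutator G x y \<in> lower_central G (Suc 0)"
      using that commutator_lower_central [of x 0 y] by simp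
    then have "commutator G (commutator G x y) b \<in> ?N"
      using that unfolding numeral_2_eq_2
      by (intro commutator_lower_central [of "commutator G x y"])
    then show ?thesis
      using that p.commutator_in_kernel_iff [of "commutator G x y" b]
      unfolding ker by simp
  qed
  obtain e :: int where "\<forall>h. group_hom G ?Q h \<longrightarrow> (\<forall>x \<in> carrier G.
      (\<forall>y \<in> carrier G. h x \<otimes>\<^bsub>?Q\<^esub> h y = h y \<otimes>\<^bsub>?Q\<^esub> h x) \<longrightarrow> h (f x) = h x [^]\<^bsub>?Q\<^esub> e)"
    using polynomial_automorphism_power [OF f] by (rule exE)
  then have e: "h (f x) = h x [^]\<^bsub>?Q\<^esub> e"
    if "group_hom G ?Q h" "x \<in> carrier G"
      "\<And>y. y \<in> carrier G \<Longrightarrow> h x \<otimes>\<^bsub>?Q\<^esub> h y = h y \<otimes>\<^bsub>?Q\<^esub> h x" for h x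
    using that by simp
  have bilinear: "group_hom G ?Q (\<lambda>x. p (commutator G x y))" if y: "y \<in> carrier G" for y
  proof
    show "(\<lambda>x. p (commutator G x y)) \<in> hom G ?Q"
    proof (rule homI)
      fix a b assume ab: "a \<in> carrier G" "b \<in> carrier G"
      have "p (commutator G (a \<otimes> b) y) = p (commutator G b y) \<otimes>\<^bsub>?Q\<^esub> p (commutator G a y)"
        using ab y cent [of b y a]
        by (simp only: p.hom_commutator p.hom_mult m_closed)
          (rule p.H.commutator_mult_left; simp)
      \<comment> \<open>The factors came out in reverse order; commutators are central modulo
        \<open>?N\<close>, which allows the swap.\<close>
      then show "p (commutator G (a \<otimes> b) y) = p (commutator G a y) \<otimes>\<^bsub>?Q\<^esub> p (commutator G b y)"
        using ab y cent [of b y "commutator G a y"] by simp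
    qed (use y in simp)
  qed
  have *: "p (commutator G x y) = p (commutator G x (f y))"
    if xy: "x \<in> carrier G" "y \<in> carrier G" for x y
  proof -
    obtain w where w: "w \<in> carrier G" "x = f w"
      by (rule auto_surj [OF fa xy(1)])
    have wy: "commutator G w y \<in> carrier G"
      using w(1) xy(2) by simp
    \<comment> \<open>The same exponent is used for two homomorphisms: first for the commutator with
      \<open>y\<close>, as a function of \<open>w\<close>, then for \<open>p\<close> at the
      commutator itself.\<close>
    have "p (commutator G (f w) y) = p (commutator G w y) [^]\<^bsub>?Q\<^esub> e"
      by (rule e [OF bilinear [OF xy(2)] w(1)], rule cent) (use w(1) xy(2) in simp_all)
    also have "\<dots> = p (f (commutator G w y))"
      by (rule e [OF p.group_hom_axioms wy, symmetric], rule cent) (use w(1) xy(2) in simp_all)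
    finally show ?thesis
      using w xy by (simp add: f.hom_commutator)
  qed
  have "commutator G (f y \<otimes> inv y) x \<in> ?N" if xy: "x \<in> carrier G" "y \<in> carrier G" for x y
  proof -
    \<comment> \<open>The commutation obtained concerns
      \<open>y \<otimes> v \<otimes> inv y\<close>, so \<open>v\<close> is chosen to make this the
      given \<open>x\<close>.\<close>
    define v where "v = inv y \<otimes> x \<otimes> y"
    have v: "v \<in> carrier G" "y \<otimes> v \<otimes> inv y = x"
      using xy by (simp_all add: v_def m_assoc)
    have "p (f y \<otimes> inv y) \<otimes>\<^bsub>?Q\<^esub> p (y \<otimes> v \<otimes> inv y) = p (y \<otimes> v \<otimes> inv y) \<otimes>\<^bsub>?Q\<^esub> p (f y \<otimes> inv y)"
      using p.H.commutator_eq_imp_commute [of "p v" "p y" "p (f y)"] * [of v y] v(1) xy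
      by (simp add: p.hom_commutator)
    then show ?thesis
      using xy fa p.commutator_in_kernel_iff [of "f y \<otimes> inv y" x]
      unfolding ker v(2) by simp
  qed
  then show ?thesis
    using fa by (simp add: trivial_mod_def central_mod_def)
qed

section \<open>The group \<open>PolyAut G\<close> and the upper bound on its class\<close>

lemma PolyAut_subset_auto: "carrier (PolyAut G) \<subseteq> auto G"
  using group.carrier_subgroup_generated_subset [OF AutoGroup] unfolding PolyAut_def by simp

lemma group_PolyAut: "group (PolyAut G)"
  unfolding PolyAut_def by (rule group.group_subgroup_generated [OF AutoGroup])

lemma PolyAut_minimal:
  assumes "subgroup S (AutoGroup G)" "\<And>f. polynomial_automorphism G f \<Longrightarrow> f \<in> S"
  shows "carrier (PolyAut G) \<subseteq> S"
  unfolding PolyAut_def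
  by (rule group.subgroup_generated_minimal [OF AutoGroup]) (use assms in auto)

lemma mult_PolyAut [simp]: "monoid.mult (PolyAut G) = monoid.mult (AutoGroup G)"
  by (simp add: PolyAut_def)

lemma inv_PolyAut: "f \<in> carrier (PolyAut G) \<Longrightarrow> inv\<^bsub>PolyAut G\<^esub> f = inv\<^bsub>AutoGroup G\<^esub> f"
  unfolding PolyAut_def by (rule group.inv_subgroup_generated [OF AutoGroup])

lemma commutator_PolyAut:
  "f \<in> carrier (PolyAut G) \<Longrightarrow> g \<in> carrier (PolyAut G) \<Longrightarrow>
    commutator (PolyAut G) f g = commutator (AutoGroup G) f g"
  by (simp add: commutator_def inv_PolyAut)

text \<open>Generation inside \<open>PolyAut G\<close> can thereby be tested against subgroups of
  \<open>AutoGroup G\<close>.\<close>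

lemma subgroup_Int_PolyAut:
  assumes "subgroup S (AutoGroup G)"
  shows "subgroup (S \<inter> carrier (PolyAut G)) (PolyAut G)"
proof -
  interpret P: group "PolyAut G" by (rule group_PolyAut)
  interpret S: subgroup S "AutoGroup G" by (rule assms)
  have "\<one>\<^bsub>AutoGroup G\<^esub> = \<one>\<^bsub>PolyAut G\<^esub>" by (simp add: PolyAut_def)
  then have "\<one>\<^bsub>PolyAut G\<^esub> \<in> S" using S.one_closed by simp
  then show ?thesis
    using P.m_closed P.inv_closed
    by (intro P.subgroupI) (auto simp: inv_PolyAut)
qed

text \<open>The automorphisms commuting with \<open>a\<close> modulo the normal subgroup
  \<open>?T\<close> form a subgroup, so it is enough to treat polynomial ones, to which
  \<open>polynomial_automorphism_commutes_mod_kernel\<close> applies with the quotient map.\<close>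

lemma commutator_trivial_mod_central_mod:
  assumes a: "a \<in> trivial_mod G (central_mod G (lower_central G n))"
    and f: "f \<in> carrier (PolyAut G)"
  shows "commutator (AutoGroup G) a f \<in> trivial_mod G (lower_central G n)"
proof -
  let ?N = "lower_central G n" and ?T = "trivial_mod G (lower_central G n)"
  interpret A: group "AutoGroup G" by (rule AutoGroup)
  interpret N: normal ?N G by (rule normal_lower_central)
  interpret p: group_hom G "G Mod ?N" "(#>) ?N" by (rule N.group_hom_r_coset)
  interpret T: normal ?T "AutoGroup G"
    by (intro normal_trivial_mod subgroup_lower_central auto_lower_central)
  have aa: "a \<in> auto G" and cent: "\<And>x. x \<in> carrier G \<Longrightarrow> a x \<otimes> inv x \<in> central_mod G ?N"
    using a by (simp_all add: trivial_mod_def)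
  have "carrier (PolyAut G) \<subseteq> {f \<in> carrier (AutoGroup G). commutator (AutoGroup G) f a \<in> ?T}"
  proof (rule PolyAut_minimal)
    show "subgroup {f \<in> carrier (AutoGroup G). commutator (AutoGroup G) f a \<in> ?T} (AutoGroup G)"
      by (rule A.subgroup_centralizer_mod) (use T.normal_axioms aa in auto)
    fix g assume g: "polynomial_automorphism G g"
    then have ga: "g \<in> auto G" by (simp add: polynomial_automorphism_def)
    have "g (a x) \<otimes> inv (a (g x)) \<in> ?N" if x: "x \<in> carrier G" for x
    proof -
      have "?N #> a (g x) = ?N #> g (a x)"
        by (rule p.polynomial_automorphism_commutes_mod_kernel)
          (use aa cent g x in \<open>simp_all add: N.kernel_r_coset\<close>)
      then show ?thesis
        using p.quotient_in_kernel_iff [of "g (a x)" "a (g x)"] aa ga x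
        by (simp add: N.kernel_r_coset)
    qed
    then have "commutator (AutoGroup G) g a \<in> ?T"
      by (intro commutator_in_trivial_mod ga aa)
    then show "g \<in> {f \<in> carrier (AutoGroup G). commutator (AutoGroup G) f a \<in> ?T}"
      using ga by simp
  qed
  then have fa: "f \<in> auto G" and "commutator (AutoGroup G) f a \<in> ?T"
    using f by auto
  \<comment> \<open>The subgroup argument needs \<open>a\<close> in second place; inversion restores
    the order.\<close>
  then have "inv\<^bsub>AutoGroup G\<^esub> (commutator (AutoGroup G) f a) \<in> ?T" by simp
  then show ?thesis using fa aa by (simp add: A.inv_commutator)
qed

text \<open>The generators of the next term are commutators covered by
  \<open>commutator_trivial_mod_central_mod\<close>. The conclusion keeps
  \<open>lower_central G m\<close> itself, because for the last term of the series this is the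
  trivial group.\<close>

lemma lower_central_PolyAut_step:
  assumes "lower_central (PolyAut G) n \<subseteq> trivial_mod G (central_mod G (lower_central G m))"
  shows "lower_central (PolyAut G) (Suc n) \<subseteq> trivial_mod G (lower_central G m)"
proof -
  let ?T = "trivial_mod G (lower_central G m)"
  interpret P: group "PolyAut G" by (rule group_PolyAut)
  have T: "subgroup ?T (AutoGroup G)"
    by (intro subgroup_trivial_mod subgroup_lower_central auto_lower_central)
  have c: "commutator (PolyAut G) f g \<in> ?T \<inter> carrier (PolyAut G)"
    if fg: "f \<in> lower_central (PolyAut G) n" "g \<in> carrier (PolyAut G)" for f g
  proof -
    have "f \<in> carrier (PolyAut G)"
      using fg(1) by (rule subgroup.mem_carrier [OF P.subgroup_lower_central])
    then show ?thesis
      using commutator_trivial_mod_central_mod [of f m g] fg assms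
      by (auto simp: commutator_PolyAut P.commutator_closed simp flip: commutator_PolyAut)
  qed
  have "lower_central (PolyAut G) (Suc n) \<subseteq> ?T \<inter> carrier (PolyAut G)"
    unfolding lower_central.simps
    by (rule P.generate_subgroup_incl [OF _ subgroup_Int_PolyAut [OF T]])
      (use c in \<open>auto simp: commutator_def\<close>)
  then show ?thesis by blast
qed

text \<open>Indices start at 0, so \<open>lower_central G 2\<close> is the third term, and the case
  \<open>n = 0\<close> is \<open>polynomial_automorphism_central\<close> extended to the generated
  group.\<close>

lemma lower_central_PolyAut_upper:
  "lower_central (PolyAut G) n \<subseteq> trivial_mod G (central_mod G (lower_central G (n + 2)))"
proof (induction n)
  case 0
  have "subgroup (trivial_mod G (central_mod G (lower_central G 2))) (AutoGroup G)"
    by (intro subgroup_trivial_mod subgroup_central_mod normal_lower_central)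
      (intro auto_central_mod auto_lower_central)
  then show ?case
    using PolyAut_minimal [OF _ polynomial_automorphism_central]
    by (simp only: lower_central.simps(1) add_0)
next
  case (Suc n)
  \<comment> \<open>Each term is central modulo the next, which restores the shape of the induction
    hypothesis.\<close>
  have "trivial_mod G (lower_central G (n + 2))
      \<subseteq> trivial_mod G (central_mod G (lower_central G (Suc n + 2)))"
    using lower_central_subset_central_mod [of "n + 2"]
    by (auto simp: trivial_mod_def simp del: lower_central.simps)
  then show ?case
    using lower_central_PolyAut_step [OF Suc] by blast
qed

section \<open>Inner automorphisms and the lower bound\<close>

definition conjugation :: "'a \<Rightarrow> 'a \<Rightarrow> 'a" where
  "conjugation g = (\<lambda>x \<in> carrier G. g \<otimes> x \<otimes> inv g)"

lemma conjugation_auto: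
  assumes g: "g \<in> carrier G"
  shows "conjugation g \<in> auto G"
proof -
  have "bij_betw (conjugation g) (carrier G) (carrier G)"
    by (rule bij_betwI [where g = "conjugation (inv g)"])
      (auto simp: conjugation_def g m_assoc)
  moreover have "conjugation g \<in> hom G G"
    by (rule homI) (simp_all add: conjugation_def g m_assoc)
  \<comment> \<open>The restriction to \<open>carrier G\<close> in \<open>conjugation\<close> serves
    this condition, which is part of \<open>Bij\<close>.\<close>
  moreover have "conjugation g \<in> extensional (carrier G)"
    by (simp add: conjugation_def)
  ultimately show ?thesis
    by (simp add: auto_def Bij_def)
qed

lemma conjugation_polynomial:
  assumes g: "g \<in> carrier G"
  shows "polynomial_automorphism G (conjugation g)"
  unfolding polynomial_automorphism_def
proof (intro conjI bexI exI [of _ "[(1, inv g)]"] ballI)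
  show "conjugation g \<in> auto G" by (rule conjugation_auto [OF g])
qed (auto simp: g word_map_def conjugation_def)

lemma group_hom_conjugation: "group_hom G (PolyAut G) conjugation"
proof -
  have mem: "conjugation g \<in> carrier (PolyAut G)" if "g \<in> carrier G" for g
    using conjugation_polynomial [OF that] conjugation_auto [OF that]
    by (auto simp: PolyAut_def carrier_subgroup_generated intro: generate.incl)
  have "conjugation (g \<otimes> k) = conjugation g \<otimes>\<^bsub>PolyAut G\<^esub> conjugation k"
    if gk: "g \<in> carrier G" "k \<in> carrier G" for g k
  proof (rule auto_eqI)
    fix x assume "x \<in> carrier G"
    then show "conjugation (g \<otimes> k) x = (conjugation g \<otimes>\<^bsub>PolyAut G\<^esub> conjugation k) x"
      using gk by (simp add: AutoGroup_mult_apply conjugation_auto)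
        (simp add: conjugation_def m_assoc inv_mult_group)
  qed (use gk in \<open>simp_all add: conjugation_auto\<close>)
  with mem show ?thesis
    by (intro group_hom.intro group_hom_axioms.intro homI is_group group_PolyAut)
qed

text \<open>If term \<open>d\<close> of \<open>PolyAut G\<close> is trivial, then so is conjugation
  by any element of term \<open>d\<close> of \<open>G\<close>. Such elements are central, so the
  next term of \<open>G\<close> vanishes; this is the shift by one in the class.\<close>

lemma lower_central_PolyAut_lower:
  assumes "lower_central (PolyAut G) d = {\<one>\<^bsub>PolyAut G\<^esub>}"
  shows "lower_central G (Suc d) = {\<one>}"
proof -
  have "g \<otimes> x \<otimes> inv g \<otimes> inv x = \<one>" if g: "g \<in> lower_central G d" and x: "x \<in> carrier G" for g x
  proof -
    have "conjugation g = \<one>\<^bsub>PolyAut G\<^esub>"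
      using group_hom.hom_lower_central [OF group_hom_conjugation g] assms by simp
    then have "conjugation g x = x"
      using x by (simp add: PolyAut_def AutoGroup_one_apply)
    then show ?thesis using x by (simp add: conjugation_def)
  qed
  then have "lower_central G (Suc d) \<subseteq> {\<one>}"
    unfolding lower_central.simps
    by (intro generate_subgroup_incl triv_subgroup) auto
  then show ?thesis
    using subgroup.one_closed [OF subgroup_lower_central] by blast
qed

end

section \<open>The two bounds on the class combined\<close>

theorem theorem1p1:
  fixes G :: "('a, 'b) monoid_scheme" and k :: nat
  assumes "group G" and "k \<ge> 2" and "nilpotent_of_class G k"
  shows "nilpotent_of_class (PolyAut G) (k - 1)"
proof -
  interpret group G by (rule assms(1))
  interpret P: group "PolyAut G" by (rule group_PolyAut)
  have top: "lower_central G k = {\<one>\<^bsub>G\<^esub>}" and less: "\<And>d. d < k \<Longrightarrow> lower_central G d \<noteq> {\<one>\<^bsub>G\<^esub>}"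
    using assms(3) by (auto simp: nilpotent_of_class_def)
  \<comment> \<open>Term \<open>Suc n\<close> of \<open>PolyAut G\<close> acts trivially modulo term
    \<open>n + 2\<close> of \<open>G\<close>, which for this \<open>n\<close> is the trivial term
    \<open>k\<close>.\<close>
  obtain n where k: "k = n + 2"
    using assms(2) by (metis add.commute le_Suc_ex)
  have "f = \<one>\<^bsub>PolyAut G\<^esub>" if "f \<in> lower_central (PolyAut G) (Suc n)" for f
  proof -
    have f: "f \<in> trivial_mod G {\<one>\<^bsub>G\<^esub>}"
      using lower_central_PolyAut_step [OF lower_central_PolyAut_upper [of n]] that top
      by (auto simp: k simp del: lower_central.simps)
    show ?thesis
    proof (rule auto_eqI)
      fix x assume x: "x \<in> carrier G"
      then have "f x \<otimes>\<^bsub>G\<^esub> inv\<^bsub>G\<^esub> x = \<one>\<^bsub>G\<^esub>" "f x \<in> carrier G"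
        using f by (auto simp: trivial_mod_def)
      then have "f x = x" using x by (metis inv_equality inv_inv inv_closed)
      then show "f x = \<one>\<^bsub>PolyAut G\<^esub> x" using x by (simp add: PolyAut_def AutoGroup_one_apply)
    qed (use f PolyAut_subset_auto P.one_closed in \<open>auto simp: trivial_mod_def\<close>)
  qed
  then have "lower_central (PolyAut G) (k - 1) = {\<one>\<^bsub>PolyAut G\<^esub>}"
    using subgroup.one_closed [OF P.subgroup_lower_central] by (auto simp: k simp del: lower_central.simps)
  \<comment> \<open>A trivial term at such a \<open>d\<close> would make term \<open>Suc d\<close>
    of \<open>G\<close> trivial, although \<open>Suc d < k\<close>.\<close>
  moreover have "lower_central (PolyAut G) d \<noteq> {\<one>\<^bsub>PolyAut G\<^esub>}" if "d < k - 1" for d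
    using lower_central_PolyAut_lower [of d] less [of "Suc d"] that by linarith
  ultimately show ?thesis
    by (simp add: nilpotent_of_class_def P.is_group)
qed

end
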